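(* Let $I\subset\mathbb{R}$ be an open interval, let $\theta\in\mathbb{R}$ with $\theta\neq \frac{k\pi}{2}$ for all $k\in\mathbb{Z}$, and let $c_1,c_2\in\mathbb{R}$ with $c_1\neq 0$. Let $\alpha:I\to\mathbb{R}^3$ be the space curve $$\alpha(s)=-\frac{\sqrt{1+(c_1s+c_2)^2}}{c_1}\Bigl(\cos(\theta)\cos\bigl[\sec(\theta)\arctan(c_1s+c_2)\bigr],\ \cos(\theta)\sin\bigl[\sec(\theta)\arctan(c_1s+c_2)\bigr],\ -\sin(\theta)\Bigr).$$ Then $\alpha$ is a unit speed rectifying slant helix which lies on the cone $$\tan^2(\theta)\,(x^2+y^2)=z^2.$$
   Context: $\mathbb{R}^3$ carries the Euclidean metric $g$. A curve is unit speed if $g(\alpha',\alpha')=1$. For a unit speed curve with $t'(s)\neq 0$ for all $s$ (where $t=\alpha'$; this is a standing assumption on curves), the Frenet frame $\{t,n,b\}$ satisfies $t'=\kappa n$, $n'=-\kappa t+\tau b$, $b'=-\tau n$, with $\kappa>0$. A curve is a slant helix if its principal normal vector field $n$ makes a constant angle with a fixed line in space, i.e. there is a fixed unit vector $u$ with $g(n(s),u)$ constant. A rectifying slant helix is a unit speed slant helix whose position vector always lies in its rectifying plane, i.e. $\alpha(s)=\lambda(s)t(s)+\mu(s)b(s)$ for some functions $\lambda,\mu$. *)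

theory Defs
  imports "HOL-Analysis.Analysis"
begin

text \<open>
  A curve on an open interval \<open>I\<close> is a function on all of \<open>real\<close> of which only the values on \<open>I\<close>
  matter: since \<open>I\<close> is open, every derivative below at a point of \<open>I\<close> depends only on
  the restriction to \<open>I\<close>.
\<close>

definition velocity :: "(real \<Rightarrow> real^3) \<Rightarrow> real \<Rightarrow> real^3" where
  "velocity \<alpha> s = vector_derivative \<alpha> (at s)"

definition smooth_curve :: "real set \<Rightarrow> (real \<Rightarrow> real^3) \<Rightarrow> bool" where
  "smooth_curve I \<alpha> \<longleftrightarrow> (\<forall>k. \<forall>s\<in>I. (velocity ^^ k) \<alpha> differentiable (at s))"

definition unit_speed :: "real set \<Rightarrow> (real \<Rightarrow> real^3) \<Rightarrow> bool" where
  "unit_speed I \<alpha> \<longleftrightarrow> smooth_curve I \<alpha> \<and> (\<forall>s\<in>I. velocity \<alpha> s \<bullet> velocity \<alpha> s = 1)"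

text \<open>
  The definitions below yield the Frenet frame only for unit speed curves with
  nowhere vanishing \<open>t'\<close>; where \<open>t' = 0\<close>, \<open>principal_normal\<close> is the junk value \<open>0\<close>. This is why
  \<open>slant_helix\<close> and \<open>rectifying_curve\<close> require \<open>frenet_curve\<close>. Taking \<open>b = t \<times> n\<close> is the
  orientation for which \<open>n' = - \<kappa> t + \<tau> b\<close> and \<open>b' = - \<tau> n\<close>.
\<close>

definition tangent :: "(real \<Rightarrow> real^3) \<Rightarrow> real \<Rightarrow> real^3" where
  "tangent \<alpha> = velocity \<alpha>"

definition curvature :: "(real \<Rightarrow> real^3) \<Rightarrow> real \<Rightarrow> real" where
  "curvature \<alpha> s = norm (velocity (tangent \<alpha>) s)"

definition principal_normal :: "(real \<Rightarrow> real^3) \<Rightarrow> real \<Rightarrow> real^3" where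
  "principal_normal \<alpha> s = (1 / curvature \<alpha> s) *\<^sub>R velocity (tangent \<alpha>) s"

definition binormal :: "(real \<Rightarrow> real^3) \<Rightarrow> real \<Rightarrow> real^3" where
  "binormal \<alpha> s = cross3 (tangent \<alpha> s) (principal_normal \<alpha> s)"

definition frenet_curve :: "real set \<Rightarrow> (real \<Rightarrow> real^3) \<Rightarrow> bool" where
  "frenet_curve I \<alpha> \<longleftrightarrow> unit_speed I \<alpha> \<and> (\<forall>s\<in>I. velocity (tangent \<alpha>) s \<noteq> 0)"

definition slant_helix :: "real set \<Rightarrow> (real \<Rightarrow> real^3) \<Rightarrow> bool" where
  "slant_helix I \<alpha> \<longleftrightarrow> frenet_curve I \<alpha> \<and>
     (\<exists>u. norm u = 1 \<and> (\<exists>c. \<forall>s\<in>I. principal_normal \<alpha> s \<bullet> u = c))"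

definition rectifying_curve :: "real set \<Rightarrow> (real \<Rightarrow> real^3) \<Rightarrow> bool" where
  "rectifying_curve I \<alpha> \<longleftrightarrow> frenet_curve I \<alpha> \<and>
     (\<exists>l m :: real \<Rightarrow> real. \<forall>s\<in>I. \<alpha> s = l s *\<^sub>R tangent \<alpha> s + m s *\<^sub>R binormal \<alpha> s)"

definition rectifying_slant_helix :: "real set \<Rightarrow> (real \<Rightarrow> real^3) \<Rightarrow> bool" where
  "rectifying_slant_helix I \<alpha> \<longleftrightarrow> slant_helix I \<alpha> \<and> rectifying_curve I \<alpha>"

end

theory Submission
  imports Defs
begin

text \<open>
  Write \<open>u = c1 s + c2\<close>, \<open>w = sqrt (1 + u\<^sup>2)\<close>, \<open>k = cos \<theta>\<close>, \<open>q = sin \<theta>\<close> and let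
  \<open>\<phi> = arctan u / k\<close> be the polar angle. The curve is \<open>\<alpha> = - (w / c1) G\<close>, where
  \<open>G = (k cos \<phi>, k sin \<phi>, - q)\<close> generates the cone. Since \<open>w' = c1 u / w\<close> and
  \<open>\<phi>' = c1 / (k w\<^sup>2)\<close>, the velocity is
  \<open>t = - (u / w) G - (1 / w) (- sin \<phi>, cos \<phi>, 0)\<close>, whose two summands are orthogonal, so
  its squared length is \<open>(u\<^sup>2 + 1) / w\<^sup>2 = 1\<close>.

  The heart of the matter is the second derivative: the components along
  \<open>(- sin \<phi>, cos \<phi>, 0)\<close> cancel, because the factor \<open>1 / k\<close> in \<open>\<phi>'\<close> compensates the
  radius \<open>k\<close> of the circle traced by \<open>G\<close>, and what remains is
  \<open>t' = c1 q / (k w\<^sup>3) E\<close> with the unit vector \<open>E = (q cos \<phi>, q sin \<phi>, k)\<close>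
  (\<open>cone_curve_derivatives\<close>). The assumption on \<open>\<theta>\<close> says \<open>k \<noteq> 0\<close> and \<open>q \<noteq> 0\<close>, so \<open>t'\<close> never
  vanishes and the principal normal is \<open>E\<close> up to a constant sign.

  Both geometric claims are now read off. The third coordinate of \<open>E\<close> is the constant \<open>k\<close>,
  so the normal makes a constant angle with the axis of the cone. And \<open>E\<close> is normal
  to the cone, in particular orthogonal to the generator \<open>G\<close>; hence the position vector is
  orthogonal to the principal normal and lies in the span of tangent and binormal
  (\<open>orthonormal_expansion_cross3\<close>).

  Smoothness is not a matter of computing all derivatives: the coordinates of \<open>\<alpha>\<close> lie in an
  algebra of functions that is closed under differentiation.
\<close>

section \<open>Curves in three-space\<close>

lemma vector_3_eq_sum_axis:
  "(vector [x, y, z] :: real^3) = x *\<^sub>R axis 1 1 + y *\<^sub>R axis 2 1 + z *\<^sub>R axis 3 1"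
  by (simp add: vec_eq_iff forall_3 axis_def)

lemma has_vector_derivative_vector_3:
  assumes "(f has_real_derivative f') (at s)" "(g has_real_derivative g') (at s)"
    "(h has_real_derivative h') (at s)"
  shows "((\<lambda>s. vector [f s, g s, h s] :: real^3) has_vector_derivative vector [f', g', h']) (at s)"
  unfolding vector_3_eq_sum_axis
  by (auto intro!: derivative_eq_intros assms)

lemma scaleR_vector_3:
  "c *\<^sub>R (vector [x, y, z] :: real^3) = vector [c * x, c * y, c * z]"
  by (simp add: vec_eq_iff forall_3)

lemma inner_vector_3:
  "(vector [x, y, z] :: real^3) \<bullet> vector [x', y', z'] = x * x' + y * y' + z * z'"
  by (simp add: inner_vec_def sum_3)

text \<open>
  The velocity at a point of an open set only sees the curve on that set. This transfers
  derivatives of the globally defined formulas to a curve known on \<open>I\<close> alone.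
\<close>

lemma velocity_eq_on_open:
  assumes "open I" "s \<in> I" "\<And>x. x \<in> I \<Longrightarrow> \<alpha> x = \<beta> x" "(\<beta> has_vector_derivative d) (at s)"
  shows "\<alpha> differentiable (at s)" "velocity \<alpha> s = d"
proof -
  have "(\<alpha> has_vector_derivative d) (at s)"
    using has_vector_derivative_transform_within_open[OF assms(4,1,2)] assms(3) by metis
  then show "\<alpha> differentiable (at s)" "velocity \<alpha> s = d"
    by (auto simp: velocity_def differentiableI_vector intro: vector_derivative_at)
qed

text \<open>
  Induction on the order of the derivative needs no formula for the iterated velocities, only
  the invariant that each of them agrees on \<open>I\<close> with some member of \<open>V\<close>.
\<close>

lemma smooth_curve_if_derivation_closed:
  assumes "open I"
    and closed: "\<And>\<beta>. \<beta> \<in> V \<Longrightarrow> \<exists>\<beta>'\<in>V. \<forall>s\<in>I. (\<beta> has_vector_derivative \<beta>' s) (at s)"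
    and "\<beta> \<in> V" "\<And>s. s \<in> I \<Longrightarrow> \<alpha> s = \<beta> s"
  shows "smooth_curve I \<alpha>"
proof -
  have "\<exists>\<beta>\<in>V. \<forall>s\<in>I. (velocity ^^ k) \<alpha> s = \<beta> s" for k
  proof (induction k)
    case 0
    then show ?case using assms(3,4) by auto
  next
    case (Suc k)
    then obtain \<gamma> where \<gamma>: "\<gamma> \<in> V" "\<And>s. s \<in> I \<Longrightarrow> (velocity ^^ k) \<alpha> s = \<gamma> s" by blast
    obtain \<gamma>' where \<gamma>': "\<gamma>' \<in> V" "\<And>s. s \<in> I \<Longrightarrow> (\<gamma> has_vector_derivative \<gamma>' s) (at s)"
      using closed[OF \<gamma>(1)] by blast
    have "(velocity ^^ Suc k) \<alpha> s = \<gamma>' s" if "s \<in> I" for s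
      using velocity_eq_on_open(2)[OF \<open>open I\<close> that \<gamma>(2) \<gamma>'(2)[OF that]] by simp
    then show ?case using \<gamma>'(1) by blast
  qed
  then show ?thesis
    unfolding smooth_curve_def
    using closed velocity_eq_on_open(1)[OF \<open>open I\<close>] by metis
qed

text \<open>
  A vector orthogonal to the principal normal lies in the rectifying plane. Its part
  \<open>d\<close> orthogonal to \<open>t\<close> is orthogonal to both \<open>t\<close> and \<open>n\<close>, hence parallel to \<open>b = t \<times> n\<close>;
  the double cross product formula makes this parallelism explicit.
\<close>

lemma orthonormal_expansion_cross3:
  fixes x t n :: "real^3"
  assumes "t \<bullet> t = 1" "n \<bullet> n = 1" "t \<bullet> n = 0" "x \<bullet> n = 0"
  shows "x = (x \<bullet> t) *\<^sub>R t + (x \<bullet> cross3 t n) *\<^sub>R cross3 t n"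
proof -
  let ?b = "cross3 t n" and ?d = "x - (x \<bullet> t) *\<^sub>R t"
  have "cross3 ?d ?b = (?d \<bullet> n) *\<^sub>R t - (?d \<bullet> t) *\<^sub>R n"
    by (rule Lagrange)
  also have "\<dots> = 0"
    using assms by (simp add: inner_diff_left)
  finally have "0 = cross3 ?b (cross3 ?d ?b)"
    by simp
  also have "\<dots> = (?b \<bullet> ?b) *\<^sub>R ?d - (?b \<bullet> ?d) *\<^sub>R ?b"
    by (rule Lagrange)
  also have "?b \<bullet> ?b = 1"
    using norm_cross[of t n] assms by (simp add: power2_norm_eq_inner)
  also have "?b \<bullet> ?d = x \<bullet> ?b"
    by (simp add: inner_diff_right dot_cross_self inner_commute)
  finally show ?thesis
    by (simp add: algebra_simps)
qed

section \<open>An algebra of functions closed under differentiation\<close>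

text \<open>
  For \<open>c = 1 / cos \<theta>\<close> this contains the coordinates of the curve. The reciprocal of the root
  \<open>w\<close> is a generator rather than \<open>w\<close> itself, because differentiating any generator only
  brings in nonnegative powers of \<open>1 / w\<close>, while \<open>w\<close> is recovered as \<open>(1 + u\<^sup>2) (1 / w)\<close> with
  \<open>u = a s + b\<close>. Thus sums and products suffice, without quotients.
\<close>

inductive_set cone_algebra :: "real \<Rightarrow> real \<Rightarrow> real \<Rightarrow> (real \<Rightarrow> real) set" for a b c where
  const: "(\<lambda>s. r) \<in> cone_algebra a b c"
| affine: "(\<lambda>s. a * s + b) \<in> cone_algebra a b c"
| radical: "(\<lambda>s. 1 / sqrt (1 + (a * s + b)\<^sup>2)) \<in> cone_algebra a b c"
| cos: "(\<lambda>s. cos (c * arctan (a * s + b))) \<in> cone_algebra a b c"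
| sin: "(\<lambda>s. sin (c * arctan (a * s + b))) \<in> cone_algebra a b c"
| add: "f \<in> cone_algebra a b c \<Longrightarrow> g \<in> cone_algebra a b c \<Longrightarrow> (\<lambda>s. f s + g s) \<in> cone_algebra a b c"
| mult: "f \<in> cone_algebra a b c \<Longrightarrow> g \<in> cone_algebra a b c \<Longrightarrow> (\<lambda>s. f s * g s) \<in> cone_algebra a b c"

lemma one_plus_square_pos: "0 < 1 + (x::real)\<^sup>2"
  by (simp add: add_pos_nonneg)

lemma sqrt_square_one_plus: "sqrt (1 + (x::real)\<^sup>2) * sqrt (1 + x\<^sup>2) = 1 + x\<^sup>2"
  using one_plus_square_pos[of x] by (metis less_eq_real_def real_sqrt_mult_self abs_of_pos)

lemma DERIV_angle:
  "((\<lambda>s. c * arctan (a * s + b)) has_real_derivative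
     a * c / (sqrt (1 + (a * s + b)\<^sup>2) * sqrt (1 + (a * s + b)\<^sup>2))) (at s)"
  unfolding sqrt_square_one_plus by (auto intro!: derivative_eq_intros simp: field_simps)

lemma DERIV_radical:
  "((\<lambda>s. sqrt (1 + (a * s + b)\<^sup>2)) has_real_derivative
     a * (a * s + b) / sqrt (1 + (a * s + b)\<^sup>2)) (at s)"
  using one_plus_square_pos[of "a * s + b"]
  by (auto intro!: derivative_eq_intros simp: field_simps)

lemma cone_algebra_derivation_closed:
  assumes "f \<in> cone_algebra a b c"
  shows "\<exists>f'\<in>cone_algebra a b c. \<forall>s. (f has_real_derivative f' s) (at s)"
  using assms
proof induction
  case (const r)
  show ?case by (rule bexI[OF _ cone_algebra.const[of 0]]) auto
next
  case affine
  show ?case by (rule bexI[OF _ cone_algebra.const[of a]]) (auto intro!: derivative_eq_intros)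
next
  case radical
  let ?u = "\<lambda>s. a * s + b" and ?r = "\<lambda>s. 1 / sqrt (1 + (a * s + b)\<^sup>2)"
  have d: "((\<lambda>s. ?r s) has_real_derivative - a * (?u s * (?r s * (?r s * ?r s)))) (at s)" for s
  proof (rule DERIV_cong[OF DERIV_divide[OF DERIV_const DERIV_radical]])
    show "sqrt (1 + (?u s)\<^sup>2) \<noteq> 0"
      using one_plus_square_pos[of "?u s"] by simp
  qed (unfold divide_inverse inverse_mult_distrib, algebra)
  have m: "(\<lambda>s. - a * (?u s * (?r s * (?r s * ?r s)))) \<in> cone_algebra a b c"
    by (intro cone_algebra.intros)
  show ?case by (rule bexI[OF _ m]) (intro allI d)
next
  case cos
  let ?r = "\<lambda>s. 1 / sqrt (1 + (a * s + b)\<^sup>2)" and ?g = "\<lambda>s. c * arctan (a * s + b)"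
  have d: "((\<lambda>s. cos (?g s)) has_real_derivative (- (a * c)) * (?r s * (?r s * sin (?g s)))) (at s)" for s
    by (rule DERIV_cong[OF DERIV_fun_cos[OF DERIV_angle]])
      (unfold divide_inverse inverse_mult_distrib, algebra)
  have m: "(\<lambda>s. (- (a * c)) * (?r s * (?r s * sin (?g s)))) \<in> cone_algebra a b c"
    by (intro cone_algebra.intros)
  show ?case by (rule bexI[OF _ m]) (intro allI d)
next
  case sin
  let ?r = "\<lambda>s. 1 / sqrt (1 + (a * s + b)\<^sup>2)" and ?g = "\<lambda>s. c * arctan (a * s + b)"
  have d: "((\<lambda>s. sin (?g s)) has_real_derivative (a * c) * (?r s * (?r s * cos (?g s)))) (at s)" for s
    by (rule DERIV_cong[OF DERIV_fun_sin[OF DERIV_angle]])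
      (unfold divide_inverse inverse_mult_distrib, algebra)
  have m: "(\<lambda>s. (a * c) * (?r s * (?r s * cos (?g s)))) \<in> cone_algebra a b c"
    by (intro cone_algebra.intros)
  show ?case by (rule bexI[OF _ m]) (intro allI d)
next
  case (add f g)
  then obtain f' g' where "f' \<in> cone_algebra a b c" "g' \<in> cone_algebra a b c"
    and "\<forall>s. (f has_real_derivative f' s) (at s)" "\<forall>s. (g has_real_derivative g' s) (at s)" by blast
  then show ?case
    by (intro bexI[of _ "\<lambda>s. f' s + g' s"] cone_algebra.add) (auto intro!: derivative_eq_intros)
next
  case (mult f g)
  then obtain f' g' where "f' \<in> cone_algebra a b c" "g' \<in> cone_algebra a b c"
    and "\<forall>s. (f has_real_derivative f' s) (at s)" "\<forall>s. (g has_real_derivative g' s) (at s)" by blast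
  with mult(1,2) show ?case
    by (intro bexI[of _ "\<lambda>s. f' s * g s + g' s * f s"] cone_algebra.intros DERIV_mult allI) auto
qed

lemma smooth_curve_if_cone_algebra_coordinates:
  assumes "open I" "f \<in> cone_algebra a b c" "g \<in> cone_algebra a b c" "h \<in> cone_algebra a b c"
    and "\<And>s. s \<in> I \<Longrightarrow> \<alpha> s = vector [f s, g s, h s]"
  shows "smooth_curve I \<alpha>"
proof -
  define V :: "(real \<Rightarrow> real^3) set" where "V = {\<lambda>s. vector [f s, g s, h s] | f g h.
      f \<in> cone_algebra a b c \<and> g \<in> cone_algebra a b c \<and> h \<in> cone_algebra a b c}"
  show ?thesis
  proof (rule smooth_curve_if_derivation_closed[OF \<open>open I\<close>])
    show "(\<lambda>s. vector [f s, g s, h s]) \<in> V" using assms(2-4) unfolding V_def by blast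
    fix \<beta> assume "\<beta> \<in> V"
    then obtain f g h where \<beta>: "\<beta> = (\<lambda>s. vector [f s, g s, h s])"
      and f: "f \<in> cone_algebra a b c" and g: "g \<in> cone_algebra a b c"
      and h: "h \<in> cone_algebra a b c"
      unfolding V_def by blast
    obtain f' where f': "f' \<in> cone_algebra a b c" "\<forall>s. (f has_real_derivative f' s) (at s)"
      using cone_algebra_derivation_closed[OF f] by blast
    obtain g' where g': "g' \<in> cone_algebra a b c" "\<forall>s. (g has_real_derivative g' s) (at s)"
      using cone_algebra_derivation_closed[OF g] by blast
    obtain h' where h': "h' \<in> cone_algebra a b c" "\<forall>s. (h has_real_derivative h' s) (at s)"
      using cone_algebra_derivation_closed[OF h] by blast
    show "\<exists>\<beta>'\<in>V. \<forall>s\<in>I. (\<beta> has_vector_derivative \<beta>' s) (at s)"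
    proof (rule bexI[of _ "\<lambda>s. vector [f' s, g' s, h' s]"])
      show "(\<lambda>s. vector [f' s, g' s, h' s]) \<in> V"
        using f'(1) g'(1) h'(1) unfolding V_def by blast
      show "\<forall>s\<in>I. (\<beta> has_vector_derivative vector [f' s, g' s, h' s]) (at s)"
        using f'(2) g'(2) h'(2) unfolding \<beta> by (intro ballI has_vector_derivative_vector_3) auto
    qed
  qed (use assms(5) in auto)
qed

section \<open>The curve on the cone\<close>

text \<open>
  With \<open>k = cos \<theta>\<close>, \<open>q = sin \<theta>\<close>, \<open>a = c1\<close> and \<open>b = c2\<close> these are the tangent and its
  derivative. The acceleration has no component along \<open>(- sin \<phi>, cos \<phi>, 0)\<close>: the product rule contributes
  \<open>- (u / w) k \<phi>'\<close> from the rotation of the generator and \<open>- (1 / w)' = a u / w\<^sup>3\<close> from the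
  rotational part of the velocity, and these cancel since \<open>k \<phi>' = a / w\<^sup>2\<close>. The horizontal
  radial component is \<open>a (1 / k - k) / w\<^sup>3\<close>, which is a multiple of \<open>q\<^sup>2\<close>.
\<close>

lemma cone_curve_derivatives:
  fixes k q a b s :: real
  defines "u \<equiv> \<lambda>s. a * s + b" and "w \<equiv> \<lambda>s. sqrt (1 + (a * s + b)\<^sup>2)"
    and "\<phi> \<equiv> \<lambda>s. 1 / k * arctan (a * s + b)"
  assumes "k\<^sup>2 + q\<^sup>2 = 1" "k \<noteq> 0" "a \<noteq> 0"
  shows
    "((\<lambda>s. - (w s / a) *\<^sub>R vector [k * cos (\<phi> s), k * sin (\<phi> s), - q] :: real^3)
      has_vector_derivative vector [- u s / w s * k * cos (\<phi> s) + sin (\<phi> s) / w s,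
        - u s / w s * k * sin (\<phi> s) - cos (\<phi> s) / w s, u s / w s * q]) (at s)"
    and
    "((\<lambda>s. vector [- u s / w s * k * cos (\<phi> s) + sin (\<phi> s) / w s,
        - u s / w s * k * sin (\<phi> s) - cos (\<phi> s) / w s, u s / w s * q] :: real^3)
      has_vector_derivative (a * q / (k * w s ^ 3)) *\<^sub>R
        vector [q * cos (\<phi> s), q * sin (\<phi> s), k]) (at s)"
proof -
  have w: "w s \<noteq> 0" "1 + (u s)\<^sup>2 = w s * w s"
    using one_plus_square_pos[of "u s"] by (auto simp: u_def w_def sqrt_square_one_plus)
  have q: "q * q = 1 - k * k"
    using \<open>k\<^sup>2 + q\<^sup>2 = 1\<close> by (simp add: power2_eq_square)
  have u': "(u has_real_derivative a) (at s)"
    unfolding u_def by (auto intro!: derivative_eq_intros)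
  have w': "(w has_real_derivative a * u s / w s) (at s)"
    unfolding u_def w_def by (rule DERIV_radical)
  have \<phi>': "(\<phi> has_real_derivative a / (k * (w s * w s))) (at s)"
    using DERIV_angle[of "1 / k" a b s] unfolding \<phi>_def w_def
    by (simp only: times_divide_eq_right mult_1_right divide_divide_eq_left)
  show "((\<lambda>s. - (w s / a) *\<^sub>R vector [k * cos (\<phi> s), k * sin (\<phi> s), - q] :: real^3)
      has_vector_derivative vector [- u s / w s * k * cos (\<phi> s) + sin (\<phi> s) / w s,
        - u s / w s * k * sin (\<phi> s) - cos (\<phi> s) / w s, u s / w s * q]) (at s)"
    unfolding scaleR_vector_3 using w(1) \<open>k \<noteq> 0\<close> \<open>a \<noteq> 0\<close>
    by (intro has_vector_derivative_vector_3)
      (auto intro!: derivative_eq_intros u' w' \<phi>' simp: field_simps)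
  have radial: "((\<lambda>s. u s / w s) has_real_derivative a / w s ^ 3) (at s)"
  proof -
    have "((\<lambda>s. u s / w s) has_real_derivative (a * w s - u s * (a * u s / w s)) / (w s * w s)) (at s)"
      using w(1) by (intro DERIV_divide u' w')
    also have "(a * w s - u s * (a * u s / w s)) / (w s * w s) = a * (w s * w s - (u s)\<^sup>2) / w s ^ 3"
      using w(1) by (simp add: field_simps power2_eq_square power3_eq_cube)
    finally show ?thesis
      by (simp flip: w(2))
  qed
  have recip: "((\<lambda>s. 1 / w s) has_real_derivative - (a * u s / w s ^ 3)) (at s)"
    using w(1) by (auto intro!: derivative_eq_intros w' simp: power3_eq_cube)
  have cos': "((\<lambda>s. cos (\<phi> s)) has_real_derivative - (a / (k * (w s * w s)) * sin (\<phi> s))) (at s)"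
    and sin': "((\<lambda>s. sin (\<phi> s)) has_real_derivative a / (k * (w s * w s)) * cos (\<phi> s)) (at s)"
    by (auto intro!: derivative_eq_intros \<phi>')
  \<comment> \<open>Rewriting \<open>q\<^sup>2\<close> as \<open>1 - k\<^sup>2\<close> in the claimed value makes the comparison of the two
      sides a rational identity.\<close>
  have x: "((\<lambda>s. - (k * (u s / w s * cos (\<phi> s))) + 1 / w s * sin (\<phi> s)) has_real_derivative
      a * q / (k * w s ^ 3) * (q * cos (\<phi> s))) (at s)"
    (is "(_ has_real_derivative ?x) _")
  proof -
    have "?x = a * (q * q) / (k * w s ^ 3) * cos (\<phi> s)" by simp
    then show ?thesis unfolding q
      using w(1) \<open>k \<noteq> 0\<close>
      by (intro DERIV_cong[OF DERIV_add[OF DERIV_minus[OF DERIV_cmult[OF DERIV_mult[OF radial cos']]]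
          DERIV_mult[OF recip sin']]])
        (simp add: field_simps power3_eq_cube)
  qed
  have y: "((\<lambda>s. - (k * (u s / w s * sin (\<phi> s))) - 1 / w s * cos (\<phi> s)) has_real_derivative
      a * q / (k * w s ^ 3) * (q * sin (\<phi> s))) (at s)"
    (is "(_ has_real_derivative ?y) _")
  proof -
    have "?y = a * (q * q) / (k * w s ^ 3) * sin (\<phi> s)" by simp
    then show ?thesis unfolding q
      using w(1) \<open>k \<noteq> 0\<close>
      by (intro DERIV_cong[OF DERIV_diff[OF DERIV_minus[OF DERIV_cmult[OF DERIV_mult[OF radial sin']]]
          DERIV_mult[OF recip cos']]])
        (simp add: field_simps power3_eq_cube)
  qed
  have z: "((\<lambda>s. u s / w s * q) has_real_derivative a * q / (k * w s ^ 3) * k) (at s)"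
    using \<open>k \<noteq> 0\<close> by (intro DERIV_cong[OF DERIV_cmult_right[OF radial]]) simp
  show "((\<lambda>s. vector [- u s / w s * k * cos (\<phi> s) + sin (\<phi> s) / w s,
        - u s / w s * k * sin (\<phi> s) - cos (\<phi> s) / w s, u s / w s * q] :: real^3)
      has_vector_derivative (a * q / (k * w s ^ 3)) *\<^sub>R
        vector [q * cos (\<phi> s), q * sin (\<phi> s), k]) (at s)"
    using has_vector_derivative_vector_3[OF x y z] unfolding scaleR_vector_3 by (simp add: mult_ac)
qed

theorem lemma1:
  fixes I :: "real set" and \<theta> c1 c2 :: real and \<alpha> :: "real \<Rightarrow> real^3"
  assumes "open I" and "is_interval I"
    and "\<forall>k::int. \<theta> \<noteq> of_int k * pi / 2"
    and "c1 \<noteq> 0"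
    and "\<forall>s\<in>I. \<alpha> s = (- (sqrt (1 + (c1 * s + c2)\<^sup>2) / c1)) *\<^sub>R
           vector [cos \<theta> * cos ((1 / cos \<theta>) * arctan (c1 * s + c2)),
                   cos \<theta> * sin ((1 / cos \<theta>) * arctan (c1 * s + c2)),
                   - sin \<theta>]"
  shows "unit_speed I \<alpha> \<and> rectifying_slant_helix I \<alpha> \<and>
    (\<forall>s\<in>I. (tan \<theta>)\<^sup>2 * ((\<alpha> s $ 1)\<^sup>2 + (\<alpha> s $ 2)\<^sup>2) = (\<alpha> s $ 3)\<^sup>2)"
proof -
  define k where "k = cos \<theta>"
  define q where "q = sin \<theta>"
  define u where "u s = c1 * s + c2" for s
  define w where "w s = sqrt (1 + (c1 * s + c2)\<^sup>2)" for s
  define \<phi> where "\<phi> s = 1 / k * arctan (c1 * s + c2)" for s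
  define G :: "real \<Rightarrow> real^3" where "G s = vector [k * cos (\<phi> s), k * sin (\<phi> s), - q]" for s
  define E :: "real \<Rightarrow> real^3" where "E s = vector [q * cos (\<phi> s), q * sin (\<phi> s), k]" for s
  define T :: "real \<Rightarrow> real^3" where
    "T s = vector [- u s / w s * k * cos (\<phi> s) + sin (\<phi> s) / w s,
      - u s / w s * k * sin (\<phi> s) - cos (\<phi> s) / w s, u s / w s * q]" for s
  define \<rho> where "\<rho> s = c1 * q / (k * w s ^ 3)" for s
  have kq: "k\<^sup>2 + q\<^sup>2 = 1"
    by (simp add: k_def q_def)
  have "k \<noteq> 0"
    using assms(3) unfolding k_def cos_zero_iff_int by auto
  have "q \<noteq> 0"
    using assms(3) unfolding q_def sin_zero_iff_int by auto
  have wpos: "0 < w s" and w2: "(w s)\<^sup>2 = 1 + (u s)\<^sup>2" for s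
    using one_plus_square_pos[of "u s"] by (auto simp: w_def u_def)
  have \<alpha>: "\<alpha> s = - (w s / c1) *\<^sub>R G s" if "s \<in> I" for s
    using assms(5) that by (simp add: w_def G_def k_def q_def \<phi>_def)
  have \<alpha>': "((\<lambda>s. - (w s / c1) *\<^sub>R G s) has_vector_derivative T s) (at s)"
    and T': "(T has_vector_derivative \<rho> s *\<^sub>R E s) (at s)" for s
    using cone_curve_derivatives[OF kq \<open>k \<noteq> 0\<close> \<open>c1 \<noteq> 0\<close>, of c2 s]
    by (simp_all add: T_def [abs_def] G_def E_def \<rho>_def u_def w_def \<phi>_def)
  have t: "tangent \<alpha> s = T s" if "s \<in> I" for s
    unfolding tangent_def by (rule velocity_eq_on_open(2)[OF \<open>open I\<close> that \<alpha> \<alpha>'])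
  have t': "velocity (tangent \<alpha>) s = \<rho> s *\<^sub>R E s" if "s \<in> I" for s
    by (rule velocity_eq_on_open(2)[OF \<open>open I\<close> that t T'])
  have TT: "T s \<bullet> T s = 1" for s
  proof -
    have "T s \<bullet> T s = (u s / w s)\<^sup>2 * (k\<^sup>2 * ((sin (\<phi> s))\<^sup>2 + (cos (\<phi> s))\<^sup>2) + q\<^sup>2)
        + (1 / w s)\<^sup>2 * ((sin (\<phi> s))\<^sup>2 + (cos (\<phi> s))\<^sup>2)"
      unfolding T_def inner_vector_3 divide_inverse by algebra
    also have "\<dots> = ((u s)\<^sup>2 + 1) / (w s)\<^sup>2"
      by (simp add: kq power_divide add_divide_distrib)
    also have "\<dots> = 1"
      using wpos[of s] by (simp add: w2 [symmetric] add.commute)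
    finally show ?thesis .
  qed
  have EE: "E s \<bullet> E s = 1" for s
  proof -
    have "E s \<bullet> E s = q\<^sup>2 * ((cos (\<phi> s))\<^sup>2 + (sin (\<phi> s))\<^sup>2) + k\<^sup>2"
      unfolding E_def inner_vector_3 by algebra
    then show ?thesis
      using kq by simp
  qed
  have TE: "T s \<bullet> E s = 0" for s
  proof -
    have "T s \<bullet> E s = u s / w s * k * q * (1 - ((cos (\<phi> s))\<^sup>2 + (sin (\<phi> s))\<^sup>2))"
      unfolding T_def E_def inner_vector_3 divide_inverse by algebra
    then show ?thesis
      by simp
  qed
  have GE: "G s \<bullet> E s = 0" for s
  proof -
    have "G s \<bullet> E s = k * q * ((cos (\<phi> s))\<^sup>2 + (sin (\<phi> s))\<^sup>2 - 1)"
      unfolding G_def E_def inner_vector_3 by algebra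
    then show ?thesis
      by simp
  qed
  have "norm (E s) = 1" for s
    using EE[of s] by (simp add: norm_eq_1)
  then have n: "principal_normal \<alpha> s = sgn (\<rho> s) *\<^sub>R E s" if "s \<in> I" for s
    using t'[OF that] by (simp add: principal_normal_def curvature_def sgn_real_def)
  \<comment> \<open>The sign of \<open>\<rho>\<close> does not depend on \<open>s\<close>, so the principal normal does not jump
      between \<open>E\<close> and \<open>- E\<close> and its angle with the axis stays constant.\<close>
  have \<rho>: "\<rho> s \<noteq> 0" "sgn (\<rho> s) = sgn (c1 * q / k)" for s
    using \<open>c1 \<noteq> 0\<close> \<open>q \<noteq> 0\<close> \<open>k \<noteq> 0\<close> wpos[of s]
    by (simp_all add: \<rho>_def sgn_mult sgn_divide)
  have "smooth_curve I \<alpha>"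
  proof (rule smooth_curve_if_cone_algebra_coordinates[OF \<open>open I\<close>])
    let ?A = "cone_algebra c1 c2 (1 / k)"
    let ?h = "\<lambda>s. - (1 / c1) * ((1 + u s * u s) * (1 / w s))"
    show "(\<lambda>s. ?h s * (k * cos (\<phi> s))) \<in> ?A" "(\<lambda>s. ?h s * (k * sin (\<phi> s))) \<in> ?A" "(\<lambda>s. ?h s * - q) \<in> ?A"
      unfolding u_def w_def \<phi>_def by (intro cone_algebra.intros)+
    \<comment> \<open>The root is replaced by its reciprocal, which is the generator.\<close>
    have h: "- (w s / c1) = ?h s" for s
      using wpos[of s] by (simp flip: w2 power2_eq_square) (simp add: power2_eq_square)
    show "\<alpha> s = vector [?h s * (k * cos (\<phi> s)), ?h s * (k * sin (\<phi> s)), ?h s * - q]"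
      if "s \<in> I" for s
      unfolding \<alpha>[OF that] G_def scaleR_vector_3 h ..
  qed
  then have unit: "unit_speed I \<alpha>"
    using t TT by (simp add: unit_speed_def tangent_def)
  have "E s \<noteq> 0" for s
    using EE[of s] by auto
  then have frenet: "frenet_curve I \<alpha>"
    using unit t' \<rho>(1) by (simp add: frenet_curve_def)
  have "E s \<bullet> axis 3 1 = k" for s
    by (simp add: E_def inner_axis)
  then have "\<forall>s\<in>I. principal_normal \<alpha> s \<bullet> axis 3 1 = sgn (c1 * q / k) * k"
    using n \<rho>(2) by simp
  then have "slant_helix I \<alpha>"
    using frenet unfolding slant_helix_def by (metis norm_axis_1)
  moreover have "rectifying_curve I \<alpha>"
  proof -
    have rectifying:
      "\<alpha> s = (\<alpha> s \<bullet> tangent \<alpha> s) *\<^sub>R tangent \<alpha> s + (\<alpha> s \<bullet> binormal \<alpha> s) *\<^sub>R binormal \<alpha> s"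
      if "s \<in> I" for s
      unfolding binormal_def
    proof (rule orthonormal_expansion_cross3)
      have "sgn (\<rho> s) * sgn (\<rho> s) = 1"
        using \<rho>(1)[of s] by (simp add: sgn_real_def)
      then show "principal_normal \<alpha> s \<bullet> principal_normal \<alpha> s = 1"
        using n[OF that] EE[of s] by simp
      show "tangent \<alpha> s \<bullet> tangent \<alpha> s = 1"
        by (simp only: t[OF that] TT)
      show "tangent \<alpha> s \<bullet> principal_normal \<alpha> s = 0"
        by (simp add: t[OF that] n[OF that] TE)
      show "\<alpha> s \<bullet> principal_normal \<alpha> s = 0"
        by (simp add: \<alpha>[OF that] n[OF that] GE)
    qed
    have "\<exists>l m. \<forall>s\<in>I. \<alpha> s = l s *\<^sub>R tangent \<alpha> s + m s *\<^sub>R binormal \<alpha> s"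
      by (rule exI[of _ "\<lambda>s. \<alpha> s \<bullet> tangent \<alpha> s"], rule exI[of _ "\<lambda>s. \<alpha> s \<bullet> binormal \<alpha> s"],
          rule ballI, rule rectifying)
    with frenet show ?thesis
      unfolding rectifying_curve_def by (rule conjI)
  qed
  moreover have "(tan \<theta>)\<^sup>2 * ((\<alpha> s $ 1)\<^sup>2 + (\<alpha> s $ 2)\<^sup>2) = (\<alpha> s $ 3)\<^sup>2" if "s \<in> I" for s
  proof -
    define W where "W = - (w s / c1)"
    have coords: "\<alpha> s $ 1 = W * (k * cos (\<phi> s))" "\<alpha> s $ 2 = W * (k * sin (\<phi> s))" "\<alpha> s $ 3 = W * - q"
      by (simp_all add: \<alpha>[OF that] G_def W_def)
    have "(tan \<theta>)\<^sup>2 * ((\<alpha> s $ 1)\<^sup>2 + (\<alpha> s $ 2)\<^sup>2)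
        = (q / k * k)\<^sup>2 * W\<^sup>2 * ((sin (\<phi> s))\<^sup>2 + (cos (\<phi> s))\<^sup>2)"
      unfolding coords tan_def k_def [symmetric] q_def [symmetric] divide_inverse by algebra
    also have "\<dots> = (\<alpha> s $ 3)\<^sup>2"
      using \<open>k \<noteq> 0\<close> by (simp add: coords power_mult_distrib mult.commute)
    finally show ?thesis .
  qed
  ultimately show ?thesis
    using unit by (simp add: rectifying_slant_helix_def)
qed

end
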